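(* Let $d\geq 2$ be an integer. Set $p_0:=0$, $p_d:=2$ and $p_k:=\frac{\ln(k+2)-\ln(k)}{\ln(k+1)-\ln(k)}$ for each $k\in\{1,2,\ldots,d-1\}$. Let $p\in(0,2)$ be a real number, and let $X=\{\mathbf{x}_1,\ldots,\mathbf{x}_{d+1}\}$ be an arbitrary family of $d+1$ unit vectors in $\mathbb{R}^d$. (i) If $p\in(p_{k-1},p_k)$ for some $k\in\{1,2,\ldots,d\}$, then $$\mathrm{FP}_{p,d+1,d}(X)\geq (k+1)k^{1-p},$$ and equality holds if and only if $X=L_k^d$. (ii) If $p=p_k$ for some $k\in\{1,\ldots,d-1\}$, then $$\mathrm{FP}_{p_k,d+1,d}(X)\geq (k+1)k^{1-p_k},$$ and equality holds if and only if $X=L_k^d$ or $X=L_{k+1}^d$.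
   Context: For $p>0$ and a family $X=\{\mathbf{x}_1,\ldots,\mathbf{x}_N\}$ of $N$ unit vectors in $\mathbb{R}^d$ (Euclidean norm; repetitions among the vectors are allowed), the $p$-frame potential is $$\mathrm{FP}_{p,N,d}(X):=\sum_{i=1}^{N}\sum_{j\neq i}|\langle \mathbf{x}_i,\mathbf{x}_j\rangle|^p,$$ where $\langle\cdot,\cdot\rangle$ is the standard inner product. For $k\in\{1,\ldots,d\}$, $L_k^d=\{\mathbf{x}_1,\ldots,\mathbf{x}_{d+1}\}\subset\mathbb{R}^d$ denotes a family of $d+1$ unit vectors in $\mathbb{R}^d$ satisfying $$|\langle \mathbf{x}_i,\mathbf{x}_j\rangle|=\begin{cases}\frac1k & i,j\in\{1,\ldots,k+1\},\ i\neq j,\\ 1 & i=j,\\ 0 & \text{otherwise.}\end{cases}$$ Families are regarded as unordered and are identified when they differ by a common orthogonal transformation of $\mathbb{R}^d$ and by replacing each vector $\mathbf{x}_i$ by $c_i\mathbf{x}_i$ with $c_i\in\{1,-1\}$. Thus "$X=L_k^d$" means that, after a suitable reindexing, the vectors of $X$ satisfy the displayed condition on $|\langle \mathbf{x}_i,\mathbf{x}_j\rangle|$. *)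

theory Defs
  imports "HOL-Analysis.Analysis"
begin

text \<open>A family of \<open>N\<close> vectors is given by the values of \<open>x\<close> on \<open>{1..N}\<close>; repetitions are allowed.\<close>

definition unit_family :: "nat \<Rightarrow> (nat \<Rightarrow> real ^ 'n) \<Rightarrow> bool" where
  "unit_family N x \<longleftrightarrow> (\<forall>i\<in>{1..N}. norm (x i) = 1)"

text \<open>Used for \<open>p > 0\<close> only, where the convention \<open>0 powr p = 0\<close> is the usual one.\<close>

definition frame_potential :: "real \<Rightarrow> nat \<Rightarrow> (nat \<Rightarrow> real ^ 'n) \<Rightarrow> real" where
  "frame_potential p N x =
     (\<Sum>i\<in>{1..N}. \<Sum>j\<in>{1..N} - {i}. \<bar>x i \<bullet> x j\<bar> powr p)"

definition L_entry :: "nat \<Rightarrow> nat \<Rightarrow> nat \<Rightarrow> real" where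
  "L_entry k i j =
     (if i = j then 1
      else if i \<in> {1..k+1} \<and> j \<in> {1..k+1} then 1 / real k
      else 0)"

text \<open>
  \<open>is_L d k x\<close> renders \<open>X = L\<^sub>k\<^sup>d\<close>: families are unordered, and are identified up to a common
  orthogonal transformation and individual signs. The absolute inner products are invariant
  under those identifications, so only the reindexing \<open>\<sigma>\<close> is explicit.
\<close>

definition is_L :: "nat \<Rightarrow> nat \<Rightarrow> (nat \<Rightarrow> real ^ 'n) \<Rightarrow> bool" where
  "is_L d k x \<longleftrightarrow>
     (\<exists>\<sigma>. bij_betw \<sigma> {1..d+1} {1..d+1} \<and>
        (\<forall>i\<in>{1..d+1}. \<forall>j\<in>{1..d+1}. \<bar>x (\<sigma> i) \<bullet> x (\<sigma> j)\<bar> = L_entry k i j))"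

definition p_threshold :: "nat \<Rightarrow> nat \<Rightarrow> real" where
  "p_threshold d k =
     (if k = 0 then 0
      else if k = d then 2
      else (ln (real (k + 2)) - ln (real k)) / (ln (real (k + 1)) - ln (real k)))"

end

theory Submission
  imports Defs
begin

text \<open>
  For \<open>1 < p < 2\<close> put \<open>r = 1 / (p - 1)\<close>. Since \<open>d + 1\<close> vectors in \<open>\<real>\<^sup>d\<close> are dependent, there is
  \<open>z\<close> with \<open>\<Sum> z\<^sub>i x\<^sub>i = 0\<close> and \<open>\<Sum> z\<^sub>i\<^sup>2 = 1\<close>; pairing the relation with itself gives
  \<open>\<Sum>\<^bsub>i\<noteq>j\<^esub> |z\<^sub>i z\<^sub>j| |\<langle>x\<^sub>i, x\<^sub>j\<rangle>| \<ge> 1\<close>. By duality the potential is then bounded below in terms of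
  \<open>W = \<Sum>\<^bsub>i\<noteq>j\<^esub> |z\<^sub>i z\<^sub>j| powr (r + 1)\<close>, so \<open>W\<close> has to be maximized over the simplex of all \<open>t\<^sub>i = z\<^sub>i\<^sup>2\<close>.
  A maximizer has no two distinct nonzero coordinates: for two coordinates with fixed sum, \<open>W\<close> as
  a function of their difference has no local maximum strictly between the case of equal coordinates
  and the case of a zero coordinate. Hence \<open>t\<close> is uniform on \<open>m + 1\<close> points,
  which yields the value \<open>(m + 1) m powr (1 - p)\<close>. Its logarithm is strictly unimodal in real \<open>m > 0\<close>,
  and \<open>p < p\<^sub>k\<close> says that it increases from \<open>k\<close> to \<open>k + 1\<close>. For \<open>p \<le> 1\<close> only \<open>k = 1\<close> occurs, and
  the potential decreases in the exponent.
\<close>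

section \<open>Exchanging mass between two coordinates\<close>

text \<open>\<open>h\<close> vanishes at 0 and \<open>h'\<close> is strictly increasing on
  \<open>[0, 1)\<close>, so the chords from the origin get steeper.\<close>

lemma neg_powr_gap_quotient_mono:
  fixes b :: real
  assumes b: "b > 0" and xy: "0 < x" "x < y" "y < 1"
  defines "h \<equiv> \<lambda>t. (1 - t) powr (-b) - (1 + t) powr (-b)"
  shows "h x / x < h y / y"
proof -
  define h' where "h' = (\<lambda>t::real. b * ((1 - t) powr (-b-1) + (1 + t) powr (-b-1)))"
  define h'' where "h'' = (\<lambda>t::real. b * (b + 1) * ((1 - t) powr (-b-2) - (1 + t) powr (-b-2)))"
  have d1: "(h has_real_derivative h' t) (at t)" if "0 \<le> t" "t < 1" for t
    unfolding h_def h'_def using that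
    by (auto intro!: derivative_eq_intros simp: algebra_simps)
  have d2: "(h' has_real_derivative h'' t) (at t)" if "0 \<le> t" "t < 1" for t
    unfolding h'_def h''_def using that
    by (auto intro!: derivative_eq_intros simp: algebra_simps)
  have "\<exists>s>0. s < x \<and> h x - h 0 = (x - 0) * h' s"
    by (rule MVT2) (use xy d1 in auto)
  then obtain s where s: "0 < s" "s < x" "h x - h 0 = x * h' s" by auto
  have "\<exists>t>x. t < y \<and> h y - h x = (y - x) * h' t"
    by (rule MVT2) (use xy d1 in auto)
  then obtain t where t: "x < t" "t < y" "h y - h x = (y - x) * h' t" by auto
  have "\<exists>v>s. v < t \<and> h' t - h' s = (t - s) * h'' v"
    by (rule MVT2) (use xy s t d2 in auto)
  then obtain v where v: "s < v" "v < t" "h' t - h' s = (t - s) * h'' v" by auto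
  have "(1 + v) powr (-b-2) < (1 - v) powr (-b-2)"
    by (rule powr_less_mono2_neg) (use v s t xy b in auto)
  then have "h'' v > 0" unfolding h''_def using b by auto
  then have lt: "h' s < h' t" using v by (smt (verit) mult_pos_pos)
  have h0: "h 0 = 0" by (simp add: h_def)
  have hx: "h x = x * h' s" and hy: "h y = x * h' s + (y - x) * h' t" using s t h0 by auto
  have "y * h' s < h y"
    unfolding hy using mult_strict_left_mono[OF lt, of "y - x"] xy by (simp add: algebra_simps)
  moreover have "h x / x = h' s" using hx xy by simp
  ultimately show ?thesis using xy by (simp add: field_simps)
qed

text \<open>Normal form of an exchange between coordinates \<open>1 - t\<close> and
  \<open>1 + t\<close>: \<open>t = 0\<close> makes them equal, \<open>t = 1\<close> empties one of
  them. The weight \<open>\<rho>\<close> stands for the remaining coordinates.\<close>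

lemma symmetric_pair_profile:
  fixes a \<rho> y :: real
  assumes a: "a > 1" and \<rho>: "\<rho> \<ge> 0" and y: "0 < y" "y < 1"
  defines "G \<equiv> \<lambda>t. \<rho> * ((1 - t) powr a + (1 + t) powr a) + ((1 - t) * (1 + t)) powr a"
  shows "G y < G 0 \<or> G y < G 1"
proof (rule ccontr)
  assume "\<not> ?thesis"
  then have ge: "G y \<ge> G 0" "G y \<ge> G 1" by auto
  define b where "b = a - 1"
  define h where "h = (\<lambda>t::real. (1 - t) powr (-b) - (1 + t) powr (-b))"
  \<comment> \<open>\<open>G'\<close> has the sign of \<open>\<rho> * h t - 2 * t\<close>, and \<open>h t / t\<close> is strictly increasing, so \<open>G'\<close> changes
    sign at most once, from negative to positive.\<close>
  define G' where "G' = (\<lambda>t. a * ((1 - t) * (1 + t)) powr b * (\<rho> * h t - 2 * t))"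
  have b: "b > 0" using a by (simp add: b_def)
  have dG: "(G has_real_derivative G' t) (at t)" if "0 \<le> t" "t < 1" for t
  proof -
    have pos: "(1 - t) * (1 + t) > 0" using that by auto
    have "(G has_real_derivative \<rho> * (a * (1 + t) powr b - a * (1 - t) powr b)
        + a * ((1 - t) * (1 + t)) powr b * (- 2 * t)) (at t)"
      unfolding G_def b_def using that pos
      by (auto intro!: derivative_eq_intros simp: algebra_simps)
    moreover have "((1 - t) * (1 + t)) powr b * h t = (1 + t) powr b - (1 - t) powr b"
      unfolding h_def powr_mult[of "1 - t" "1 + t" b]
      using that by (simp add: powr_minus field_simps del: powr_mult)
    moreover have "G' t = a * (\<rho> * (((1 - t) * (1 + t)) powr b * h t))
        + a * ((1 - t) * (1 + t)) powr b * (- 2 * t)"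
      unfolding G'_def by (simp only: algebra_simps)
    ultimately show ?thesis by (simp only:) (simp add: right_diff_distrib mult.left_commute)
  qed
  have cG: "continuous_on {0..1} G"
    unfolding G_def using a by (intro continuous_on_add continuous_on_mult continuous_on_powr' continuous_intros) (auto)
  have "\<exists>s>0. s < y \<and> G y - G 0 = (y - 0) * G' s"
    by (rule MVT2) (use y dG in auto)
  then obtain s where s: "0 < s" "s < y" "G y - G 0 = y * G' s" by auto
  \<comment> \<open>\<open>dG\<close> says nothing at 1, so this side uses the form of the mean
    value theorem that asks only for continuity at the endpoints.\<close>
  have "\<exists>l t. y < t \<and> t < 1 \<and> (G has_real_derivative l) (at t) \<and> G 1 - G y = (1 - y) * l"
  proof (rule MVT)
    show "G differentiable (at t)" if "y < t" "t < 1" for t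
      using dG[of t] that y unfolding real_differentiable_def by auto
  qed (use y in \<open>auto intro!: continuous_on_subset[OF cG]\<close>)
  then obtain l t where t: "y < t" "t < 1" "(G has_real_derivative l) (at t)" "G 1 - G y = (1 - y) * l"
    by blast
  have "l = G' t" using DERIV_unique[OF t(3) dG] t y by auto
  with t ge y have "G' t \<le> 0" by (smt (verit) mult_pos_pos)
  moreover have "G' s \<ge> 0" using s ge y by (smt (verit) mult_pos_neg)
  moreover have "((1 - t) * (1 + t)) powr b > 0" "((1 - s) * (1 + s)) powr b > 0"
    using s t y by auto
  ultimately have k: "\<rho> * h s \<ge> 2 * s" "\<rho> * h t \<le> 2 * t"
    unfolding G'_def using a
    by (smt (verit) mult_pos_pos mult_pos_neg)+
  have q: "h s / s < h t / t"
    unfolding h_def by (rule neg_powr_gap_quotient_mono) (use b s t y in auto)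
  have "\<rho> \<noteq> 0" using k s by auto
  then have "\<rho> * (h s / s) < \<rho> * (h t / t)"
    using \<rho> by (intro mult_strict_left_mono[OF q]) auto
  moreover have "\<rho> * (h s / s) \<ge> 2" using k s by (simp add: field_simps)
  moreover have "\<rho> * (h t / t) \<le> 2" using k s t by (simp add: field_simps)
  ultimately show False by linarith
qed

lemma unequal_pair_improvable:
  fixes a R u v :: real
  assumes a: "a > 1" and R: "R \<ge> 0" and uv: "0 < u" "u < v"
  defines "g \<equiv> \<lambda>s t. R * (s powr a + t powr a) + s powr a * t powr a"
  shows "\<exists>s t. 0 \<le> s \<and> 0 \<le> t \<and> s + t = u + v \<and> g u v < g s t"
proof -
  define c where "c = (u + v) / 2"
  define y where "y = (v - u) / (u + v)"
  \<comment> \<open>With this weight both terms of \<open>g\<close> carry the factor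
    \<open>(c powr a)\<^sup>2\<close> after rescaling by the mean \<open>c\<close>.\<close>
  define \<rho> where "\<rho> = R / c powr a"
  have c: "c > 0" and y: "0 < y" "y < 1" using uv by (auto simp: c_def y_def)
  define G where "G = (\<lambda>t. \<rho> * ((1 - t) powr a + (1 + t) powr a) + ((1 - t) * (1 + t)) powr a)"
  have scale: "g (c * (1 - t)) (c * (1 + t)) = (c powr a)\<^sup>2 * G t" if "0 \<le> t" "t \<le> 1" for t
  proof -
    have "(c * (1 - t)) powr a = c powr a * (1 - t) powr a"
      "(c * (1 + t)) powr a = c powr a * (1 + t) powr a"
      "((1 - t) * (1 + t)) powr a = (1 - t) powr a * (1 + t) powr a"
      by (rule powr_mult)+
    with c show ?thesis
      unfolding g_def G_def \<rho>_def by (simp only:) (simp add: field_simps power2_eq_square)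
  qed
  have u: "u = c * (1 - y)" and v: "v = c * (1 + y)"
    using uv by (simp_all add: c_def y_def field_simps)
  have "G y < G 0 \<or> G y < G 1"
    unfolding G_def by (rule symmetric_pair_profile) (use a R y in \<open>auto simp: \<rho>_def\<close>)
  then obtain t where t: "0 \<le> t" "t \<le> 1" "G y < G t"
    by (meson order_refl zero_le_one)
  then have "g u v < g (c * (1 - t)) (c * (1 + t))"
    using scale[of y] scale[of t] y u v c by simp
  moreover have "c * (1 - t) + c * (1 + t) = u + v" by (simp add: c_def field_simps)
  ultimately show ?thesis using t c
    by (intro exI[of _ "c * (1 - t)"] exI[of _ "c * (1 + t)"]) auto
qed

section \<open>Maximizing the off-diagonal power sum over the simplex\<close>

text \<open>Pinning the coordinates outside \<open>I\<close> to 0 places the simplex as a closed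
  subset in a product of compact sets, where Tychonoff applies.\<close>

lemma compact_simplex_functions:
  fixes I :: "'a set"
  assumes "finite I"
  shows "compact {t :: 'a \<Rightarrow> real. (\<forall>i\<in>I. 0 \<le> t i) \<and> (\<forall>i. i \<notin> I \<longrightarrow> t i = 0) \<and> sum t I = 1}"
    (is "compact ?S")
proof -
  define K :: "'a \<Rightarrow> real set" where "K = (\<lambda>i. if i \<in> I then {0..1} else {0})"
  have "compactin (product_topology (\<lambda>i. euclidean) UNIV) (PiE UNIV K)"
    by (subst compactin_PiE) (auto simp: K_def)
  then have cK: "compact (PiE UNIV K)"
    by (simp add: euclidean_product_topology)
  have "closed {t :: 'a \<Rightarrow> real. sum t I = 1}"
    by (intro closed_Collect_eq continuous_intros continuous_on_product_coordinates)
  then have "compact (PiE UNIV K \<inter> {t. sum t I = 1})"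
    by (rule compact_Int_closed[OF cK])
  moreover have "PiE UNIV K \<inter> {t. sum t I = 1} = ?S"
  proof (intro equalityI subsetI)
    fix t assume t: "t \<in> ?S"
    have "t i \<le> 1" if "i \<in> I" for i
      using member_le_sum[of i I t] that t assms by auto
    with t show "t \<in> PiE UNIV K \<inter> {t. sum t I = 1}"
      by (auto simp: K_def PiE_def Pi_def)
  next
    fix t assume "t \<in> PiE UNIV K \<inter> {t. sum t I = 1}"
    then have t: "t i \<in> K i" "sum t I = 1" for i by auto
    from t(1) have "\<forall>i. t i \<in> (if i \<in> I then {0..1} else {0})" by (simp add: K_def)
    with t(2) show "t \<in> ?S" by (auto split: if_splits)
  qed
  ultimately show ?thesis by simp
qed

text \<open>For finite \<open>I\<close> and nonnegative \<open>t\<close> this is the sum of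
  \<open>(t i * t j) powr a\<close> over ordered pairs \<open>i \<noteq> j\<close>: the quantity
  \<open>W\<close>, with \<open>t i = (z i)\<^sup>2\<close> and \<open>2 * a = r + 1\<close>.
  Writing it as a square minus the diagonal makes two coordinates easy to isolate.\<close>

definition cross_power :: "real \<Rightarrow> 'a set \<Rightarrow> ('a \<Rightarrow> real) \<Rightarrow> real" where
  "cross_power a I t = (\<Sum>i\<in>I. t i powr a)\<^sup>2 - (\<Sum>i\<in>I. (t i powr a)\<^sup>2)"

lemma sum_remove_pair:
  fixes f :: "'a \<Rightarrow> 'b::ab_group_add"
  assumes "finite I" "i \<in> I" "j \<in> I" "i \<noteq> j"
  shows "sum f I = f i + f j + sum f (I - {i, j})"
proof -
  have "I - {i} - {j} = I - {i, j}" by auto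
  moreover have "sum f (I - {i}) = f j + sum f (I - {i} - {j})"
    by (rule sum.remove) (use assms in auto)
  moreover have "sum f I = f i + sum f (I - {i})"
    by (rule sum.remove) (use assms in auto)
  ultimately show ?thesis by (simp add: add.assoc)
qed

lemma cross_power_pair:
  fixes t :: "'a \<Rightarrow> real"
  assumes "finite I" "i \<in> I" "j \<in> I" "i \<noteq> j"
  shows "cross_power a I t = cross_power a (I - {i, j}) t
           + 2 * ((\<Sum>l\<in>I - {i, j}. t l powr a) * (t i powr a + t j powr a) + t i powr a * t j powr a)"
proof -
  note * = sum_remove_pair[OF assms]
  show ?thesis
    unfolding cross_power_def * by (simp add: power2_eq_square algebra_simps)
qed

lemma cross_power_uniform:
  assumes "finite S" "S \<noteq> {}" "S \<subseteq> I" "finite I"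
    and t: "\<And>i. i \<in> I \<Longrightarrow> t i = (if i \<in> S then 1 / real (card S) else 0)"
  shows "cross_power a I t = (real (card S) - 1) * real (card S) powr (1 - 2 * a)"
proof -
  let ?m = "real (card S)"
  have m: "?m > 0" using assms by (simp add: card_gt_0_iff)
  have "(\<Sum>i\<in>I. t i powr a) = (\<Sum>i\<in>S. (1 / ?m) powr a)"
    using assms by (intro sum.mono_neutral_cong_right) auto
  moreover have "(\<Sum>i\<in>I. (t i powr a)\<^sup>2) = (\<Sum>i\<in>S. ((1 / ?m) powr a)\<^sup>2)"
    using assms by (intro sum.mono_neutral_cong_right) auto
  ultimately have "cross_power a I t = ?m\<^sup>2 * ((1 / ?m) powr a)\<^sup>2 - ?m * ((1 / ?m) powr a)\<^sup>2"
    by (simp add: cross_power_def power_mult_distrib)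
  also have "\<dots> = (?m - 1) * (?m * ((1 / ?m) powr a)\<^sup>2)"
    by (simp add: algebra_simps power2_eq_square)
  also have "?m * ((1 / ?m) powr a)\<^sup>2 = ?m powr (1 - 2 * a)"
  proof -
    have "((1 / ?m) powr a)\<^sup>2 = (1 / ?m) powr (a + a)"
      by (simp only: powr_add power2_eq_square)
    also have "\<dots> = 1 / ?m powr (2 * a)"
      using m by (simp add: powr_divide)
    finally show ?thesis using m by (simp add: powr_diff)
  qed
  finally show ?thesis .
qed

text \<open>Two unequal positive coordinates could be replaced, with the same sum, by a strictly
  better pair from \<open>unequal_pair_improvable\<close>. So all coordinates on the support agree,
  and the total 1 fixes their value.\<close>

lemma cross_power_maximizer_uniform:
  fixes t :: "'a \<Rightarrow> real"
  assumes fin: "finite I" and a: "a > 1"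
    and t: "\<And>i. i \<in> I \<Longrightarrow> 0 \<le> t i" "sum t I = 1"
    and max: "\<And>s. (\<And>i. i \<in> I \<Longrightarrow> 0 \<le> s i) \<Longrightarrow> sum s I = 1 \<Longrightarrow> cross_power a I s \<le> cross_power a I t"
  shows "\<exists>S\<subseteq>I. S \<noteq> {} \<and> (\<forall>i\<in>I. t i = (if i \<in> S then 1 / real (card S) else 0))"
proof -
  define S where "S = {i\<in>I. t i \<noteq> 0}"
  have finS: "finite S" using fin by (simp add: S_def)
  have sumS: "sum t S = 1"
    unfolding t(2)[symmetric] S_def by (rule sum.mono_neutral_left) (use fin in auto)
  then have S: "S \<noteq> {}" by auto
  have le: "t j \<le> t i" if ij: "i \<in> S" "j \<in> S" for i j
  proof (rule ccontr)
    assume "\<not> t j \<le> t i"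
    with ij t(1) have lt: "0 < t i" "t i < t j" and I: "i \<in> I" "j \<in> I" and ne: "i \<noteq> j"
      by (auto simp: S_def less_le)
    define R where "R = (\<Sum>l\<in>I - {i, j}. t l powr a)"
    have "R \<ge> 0" by (simp add: R_def sum_nonneg)
    from unequal_pair_improvable[OF a this lt] obtain u v where uv: "0 \<le> u" "0 \<le> v"
        "u + v = t i + t j"
        "R * (t i powr a + t j powr a) + t i powr a * t j powr a
          < R * (u powr a + v powr a) + u powr a * v powr a" by blast
    define s where "s = t(i := u, j := v)"
    have "sum s I = sum t I"
    proof -
      have "sum s (I - {i, j}) = sum t (I - {i, j})"
        by (rule sum.cong) (auto simp: s_def)
      then show ?thesis
        using uv ne by (simp add: sum_remove_pair[OF fin I ne] s_def)
    qed
    moreover have "cross_power a (I - {i, j}) s = cross_power a (I - {i, j}) t"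
      unfolding cross_power_def by (auto simp: s_def)
    moreover have "(\<Sum>l\<in>I - {i, j}. s l powr a) = R"
      unfolding R_def by (rule sum.cong) (auto simp: s_def)
    moreover have "s i = u" "s j = v" using ne by (auto simp: s_def)
    ultimately have "cross_power a I t < cross_power a I s"
      using uv(4) unfolding cross_power_pair[OF fin I ne] R_def by simp
    moreover have "cross_power a I s \<le> cross_power a I t"
      by (rule max) (use t uv \<open>sum s I = sum t I\<close> in \<open>auto simp: s_def\<close>)
    ultimately show False by simp
  qed
  from S obtain i0 where i0: "i0 \<in> S" by blast
  have eq: "t i = t i0" if "i \<in> S" for i
    using le[OF that i0] le[OF i0 that] by simp
  have "sum t S = (\<Sum>i\<in>S. t i0)" by (rule sum.cong[OF refl eq])
  then have "t i0 = 1 / real (card S)" using sumS S finS by (simp add: field_simps)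
  with eq have "t i = 1 / real (card S)" if "i \<in> S" for i using that by metis
  then show ?thesis
    using S by (intro exI[of _ S]) (auto simp: S_def)
qed

text \<open>Compactness provides a maximizer, which is uniform on its support, so only the support
  sizes \<open>m\<close> are compared with \<open>B\<close>. If \<open>t\<close> reaches
  \<open>B\<close>, it is itself a maximizer and hence uniform.\<close>

lemma cross_power_le:
  fixes t :: "'a \<Rightarrow> real"
  assumes fin: "finite I" and a: "a > 1"
    and t: "\<And>i. i \<in> I \<Longrightarrow> 0 \<le> t i" "sum t I = 1"
    and bound: "\<And>m. 1 \<le> m \<Longrightarrow> m \<le> card I \<Longrightarrow> (real m - 1) * real m powr (1 - 2 * a) \<le> B"
  shows "cross_power a I t \<le> B"
    and "cross_power a I t = B \<Longrightarrow>
      \<exists>S\<subseteq>I. S \<noteq> {} \<and> (\<forall>i\<in>I. t i = (if i \<in> S then 1 / real (card S) else 0))"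
proof -
  define X where "X = {t. (\<forall>i\<in>I. 0 \<le> t i) \<and> (\<forall>i. i \<notin> I \<longrightarrow> t i = 0) \<and> sum t I = (1::real)}"
  \<comment> \<open>\<open>cross_power\<close> reads only the values on \<open>I\<close>;
    \<open>r\<close> sets the others to 0, as membership in the compact set demands.\<close>
  define r where "r = (\<lambda>s i. if i \<in> I then s i else (0::real))"
  have r: "r s \<in> X" "cross_power a I (r s) = cross_power a I s"
    if "\<And>i. i \<in> I \<Longrightarrow> 0 \<le> s i" "sum s I = 1" for s
    using that by (auto simp: r_def X_def cross_power_def)
  have "continuous_on X (cross_power a I)"
    unfolding cross_power_def X_def using a
    by (intro continuous_intros continuous_on_powr' continuous_on_product_coordinates
          continuous_on_subset[OF continuous_on_product_coordinates]) auto
  moreover have "compact X" unfolding X_def by (rule compact_simplex_functions[OF fin])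
  moreover have "X \<noteq> {}" using r[OF t] by auto
  ultimately obtain s where s: "s \<in> X" "\<And>u. u \<in> X \<Longrightarrow> cross_power a I u \<le> cross_power a I s"
    using continuous_attains_sup[of X "cross_power a I"] by blast
  have s': "\<And>i. i \<in> I \<Longrightarrow> 0 \<le> s i" "sum s I = 1" using s(1) by (auto simp: X_def)
  have max: "cross_power a I u \<le> cross_power a I s"
    if "\<And>i. i \<in> I \<Longrightarrow> 0 \<le> u i" "sum u I = 1" for u
    using s(2)[OF r(1)[OF that]] r(2)[OF that] by simp
  obtain S where S: "S \<subseteq> I" "S \<noteq> {}" "\<forall>i\<in>I. s i = (if i \<in> S then 1 / real (card S) else 0)"
    using cross_power_maximizer_uniform[OF fin a s' max] by blast
  have fS: "finite S" using S fin finite_subset by blast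
  have "cross_power a I s = (real (card S) - 1) * real (card S) powr (1 - 2 * a)"
    by (rule cross_power_uniform) (use S fS fin in auto)
  also have "\<dots> \<le> B"
    by (rule bound) (use S fS fin card_mono card_gt_0_iff[of S] in auto)
  finally have sB: "cross_power a I s \<le> B" .
  with max[OF t] show "cross_power a I t \<le> B" by simp
  show "\<exists>S\<subseteq>I. S \<noteq> {} \<and> (\<forall>i\<in>I. t i = (if i \<in> S then 1 / real (card S) else 0))"
    if eq: "cross_power a I t = B"
  proof (rule cross_power_maximizer_uniform[OF fin a t])
    show "cross_power a I u \<le> cross_power a I t" if "\<And>i. i \<in> I \<Longrightarrow> 0 \<le> u i" "sum u I = 1" for u
      using max[OF that] sB eq by simp
  qed
qed

section \<open>A dual bound with its equality case\<close>

text \<open>Strict convexity of \<open>t powr p\<close>. Zero arguments are computed directly, as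
  the derivative is used only at positive points.\<close>

lemma powr_tangent_less:
  fixes p a b :: real
  assumes p: "p > 1" and ab: "0 \<le> a" "0 \<le> b" "a \<noteq> b"
  shows "b powr p + p * b powr (p - 1) * (a - b) < a powr p"
proof -
  consider "b = 0" | "b > 0" "a = 0" | "b > 0" "a > 0" using ab by linarith
  then show ?thesis
  proof cases
    case 1
    then show ?thesis using p ab by simp
  next
    case 2
    have "b powr p = b powr (p - 1) * b" using 2 by (simp add: powr_mult_base mult.commute)
    moreover have "b powr p < p * b powr p" using 2 p by simp
    ultimately show ?thesis using 2 by (simp add: algebra_simps)
  next
    case 3
    have D: "((\<lambda>t. t powr p) has_real_derivative p * t powr (p - 1)) (at t)" if "t > 0" for t
      using has_real_derivative_powr[OF that] .
    consider "a < b" | "b < a" using ab by linarith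
    then show ?thesis
    proof cases
      case 1
      have "\<exists>s>a. s < b \<and> b powr p - a powr p = (b - a) * (p * s powr (p - 1))"
        by (rule MVT2) (use 1 3 D in auto)
      then obtain s where s: "a < s" "s < b" "b powr p - a powr p = (b - a) * (p * s powr (p - 1))"
        by blast
      have "s powr (p - 1) < b powr (p - 1)"
        using s 3 p by (intro powr_less_mono2) auto
      then have "(b - a) * (p * s powr (p - 1)) < (b - a) * (p * b powr (p - 1))"
        using 1 p by (intro mult_strict_left_mono) auto
      then show ?thesis using s by (simp add: algebra_simps)
    next
      case 2
      have "\<exists>s>b. s < a \<and> a powr p - b powr p = (a - b) * (p * s powr (p - 1))"
        by (rule MVT2) (use 2 3 D in auto)
      then obtain s where s: "b < s" "s < a" "a powr p - b powr p = (a - b) * (p * s powr (p - 1))"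
        by blast
      have "b powr (p - 1) < s powr (p - 1)"
        using s 3 p by (intro powr_less_mono2) auto
      then have "(a - b) * (p * b powr (p - 1)) < (a - b) * (p * s powr (p - 1))"
        using 2 p by (intro mult_strict_left_mono) auto
      then show ?thesis using s by (simp add: algebra_simps)
    qed
  qed
qed

text \<open>Hoelder's inequality for the conjugate exponents \<open>p\<close> and
  \<open>r + 1\<close>, obtained by adding up tangent inequalities so that equality determines every
  \<open>a e\<close>.\<close>

lemma sum_powr_dual_bound:
  fixes a w :: "'e \<Rightarrow> real" and p B :: real
  defines "r \<equiv> 1 / (p - 1)"
  assumes p: "p > 1" and fin: "finite P" and B: "B > 0"
    and nonneg: "\<And>e. e \<in> P \<Longrightarrow> 0 \<le> a e" "\<And>e. e \<in> P \<Longrightarrow> 0 \<le> w e"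
    and pairing: "1 \<le> (\<Sum>e\<in>P. w e * a e)"
    and W: "(\<Sum>e\<in>P. w e powr (r + 1)) \<le> B"
  shows "B powr (1 - p) \<le> (\<Sum>e\<in>P. a e powr p)"
    and "(\<Sum>e\<in>P. a e powr p) = B powr (1 - p) \<Longrightarrow>
      (\<Sum>e\<in>P. w e powr (r + 1)) = B \<and> (\<forall>e\<in>P. a e = w e powr r / B)"
proof -
  define W where "W = (\<Sum>e\<in>P. w e powr (r + 1))"
  define N where "N = (\<Sum>e\<in>P. w e * a e)"
  \<comment> \<open>the equality case of the dual bound, at which \<open>t powr p\<close> is replaced by its tangent\<close>
  define b where "b = (\<lambda>e. w e powr r / B)"
  define g where "g = (\<lambda>e. a e powr p - (b e powr p + p * b e powr (p - 1) * (a e - b e)))"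
  have rp: "r * p = r + 1" "r * (p - 1) = 1" using p by (simp_all add: r_def field_simps)
  have b_nonneg: "0 \<le> b e" for e using B by (simp add: b_def)
  have g_nonneg: "0 \<le> g e" if "e \<in> P" for e
    using powr_tangent_less[OF p nonneg(1)[OF that] b_nonneg[of e]]
    by (cases "a e = b e") (auto simp: g_def)
  define c where "c = B powr (1 - p)"
  have Bp: "B powr p = B * B powr (p - 1)" using B by (simp add: powr_mult_base)
  have c: "c = 1 / B powr (p - 1)" "c > 0"
    using B by (simp_all add: c_def powr_minus_divide[of B "p - 1", simplified])
  \<comment> \<open>The choice of \<open>b\<close> makes the slope equal to
    \<open>p * c * w e\<close>, so the tangents add up to an expression in \<open>N\<close> and
    \<open>W\<close> alone.\<close>
  have tangent: "b e powr p + p * b e powr (p - 1) * (a e - b e)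
      = p * c * (w e * a e) - (p - 1) * c / B * w e powr (r + 1)" if "e \<in> P" for e
  proof -
    have 1: "b e powr p = c / B * w e powr (r + 1)"
      using B by (simp add: b_def powr_divide powr_powr rp Bp c)
    have 2: "b e powr (p - 1) = c * w e"
      using B nonneg(2)[OF that] by (simp add: b_def powr_divide powr_powr rp c)
    have 3: "w e * b e = w e powr (r + 1) / B"
      using nonneg(2)[OF that] by (simp add: b_def powr_mult_base add.commute)
    have "b e powr p + p * b e powr (p - 1) * (a e - b e)
        = c / B * w e powr (r + 1) + p * c * (w e * a e) - p * c * (w e * b e)"
      unfolding 1 2 by (simp add: algebra_simps)
    then show ?thesis unfolding 3 by (simp add: algebra_simps diff_divide_distrib)
  qed
  have "(\<Sum>e\<in>P. a e powr p) = (\<Sum>e\<in>P. g e) + (\<Sum>e\<in>P. p * c * (w e * a e) - (p - 1) * c / B * w e powr (r + 1))"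
    unfolding sum.distrib[symmetric] by (rule sum.cong) (use tangent in \<open>auto simp: g_def\<close>)
  also have "\<dots> = sum g P + (p * c * N - (p - 1) * c / B * W)"
    by (simp add: sum_subtractf N_def W_def sum_distrib_left)
  \<comment> \<open>The excess over \<open>c\<close> splits into three defects, each nonnegative:
    the tangent gaps, the surplus of the pairing over 1, and the slack of \<open>W\<close> below
    \<open>B\<close>. Equality makes them all vanish.\<close>
  also have "\<dots> = c + sum g P + p * c * (N - 1) + (p - 1) * c * (1 - W / B)"
    by (simp add: algebra_simps diff_divide_distrib)
  finally have eq: "(\<Sum>e\<in>P. a e powr p) = c + sum g P + p * c * (N - 1) + (p - 1) * c * (1 - W / B)" .
  have nn: "0 \<le> sum g P" "0 \<le> p * c * (N - 1)" "0 \<le> (p - 1) * c * (1 - W / B)"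
  proof -
    have "W / B \<le> 1" using W B by (simp add: W_def)
    then show "0 \<le> (p - 1) * c * (1 - W / B)" using p c by simp
    show "0 \<le> p * c * (N - 1)" using pairing p c by (simp add: N_def)
  qed (use g_nonneg in \<open>auto intro: sum_nonneg\<close>)
  show "B powr (1 - p) \<le> (\<Sum>e\<in>P. a e powr p)"
    using eq nn by (simp add: c_def)
  assume "(\<Sum>e\<in>P. a e powr p) = B powr (1 - p)"
  then have "(\<Sum>e\<in>P. a e powr p) = c" by (simp add: c_def)
  then have z: "sum g P = 0" "(p - 1) * c * (1 - W / B) = 0"
    using eq nn by linarith+
  from z(2) have "1 - W / B = 0" using p c(2) by simp
  then have "W = B" using B by simp
  moreover have "a e = b e" if "e \<in> P" for e
  proof (rule ccontr)
    assume "a e \<noteq> b e"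
    then have "g e > 0"
      using powr_tangent_less[OF p nonneg(1)[OF that] b_nonneg[of e]] by (simp add: g_def)
    moreover have "g e = 0" using z(1) sum_nonneg_eq_0_iff[OF fin g_nonneg] that by auto
    ultimately show False by simp
  qed
  ultimately show "(\<Sum>e\<in>P. w e powr (r + 1)) = B \<and> (\<forall>e\<in>P. a e = w e powr r / B)"
    by (simp add: W_def b_def)
qed

section \<open>Unimodality in the support size\<close>

text \<open>\<open>A'\<close> has the sign of the increasing function
  \<open>t * (1 - c) - c\<close>, so once \<open>A\<close> has failed to decrease it increases
  strictly. The lemma is applied with \<open>c = p - 1\<close>.\<close>

lemma log_profile_unimodal:
  fixes c x y z :: real
  defines "A \<equiv> \<lambda>t. ln (t + 1) - c * ln t"
  assumes c: "0 < c" "c < 1" and xyz: "0 < x" "x < y" "y < z" and le: "A x \<le> A y"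
  shows "A y < A z"
proof -
  define A' where "A' = (\<lambda>t. (t * (1 - c) - c) / (t * (t + 1)))"
  have D: "(A has_real_derivative A' t) (at t)" if "t > 0" for t
    unfolding A_def A'_def using that
    by (auto intro!: derivative_eq_intros simp: field_simps)
  have "\<exists>s>x. s < y \<and> A y - A x = (y - x) * A' s"
    by (rule MVT2) (use xyz D in auto)
  then obtain s where s: "x < s" "s < y" "A y - A x = (y - x) * A' s" by blast
  have "\<exists>t>y. t < z \<and> A z - A y = (z - y) * A' t"
    by (rule MVT2) (use xyz D in auto)
  then obtain t where t: "y < t" "t < z" "A z - A y = (z - y) * A' t" by blast
  have "A' s \<ge> 0" using s le xyz by (smt (verit) mult_pos_neg)
  moreover have "s * (s + 1) > 0" using s xyz by simp
  ultimately have "s * (1 - c) - c \<ge> 0" unfolding A'_def zero_le_divide_iff by linarith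
  moreover have "s * (1 - c) < t * (1 - c)" using s t c by simp
  ultimately have "A' t > 0" using t xyz by (simp add: A'_def)
  then have "(z - y) * A' t > 0" using xyz by simp
  then show ?thesis using t by simp
qed

section \<open>Linear relations among the vectors\<close>

text \<open>\<open>dependent\<close> speaks of sets, so a repeated vector is handled separately, by
  coefficients 1 and -1 on two equal members.\<close>

lemma exists_linear_relation:
  fixes x :: "'i \<Rightarrow> 'a::euclidean_space"
  assumes fin: "finite I" and card: "DIM('a) < card I"
  shows "\<exists>z. (\<Sum>i\<in>I. z i *\<^sub>R x i) = 0 \<and> (\<exists>i\<in>I. z i \<noteq> 0)"
proof (cases "inj_on x I")
  case True
  then have "card (x ` I) = card I" by (rule card_image)
  then have "dependent (x ` I)" using card independent_bound[of "x ` I"] by auto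
  then obtain u where u: "\<exists>v\<in>x ` I. u v \<noteq> 0" "(\<Sum>v\<in>x ` I. u v *\<^sub>R v) = 0"
    using dependent_finite[of "x ` I"] fin by auto
  then show ?thesis
    by (intro exI[of _ "u \<circ> x"]) (auto simp: sum.reindex[OF True])
next
  case False
  then obtain i j where ij: "i \<in> I" "j \<in> I" "i \<noteq> j" "x i = x j" by (auto simp: inj_on_def)
  define z :: "'i \<Rightarrow> real" where "z = (\<lambda>l. if l = i then 1 else if l = j then -1 else 0)"
  have "(\<Sum>l\<in>I - {i, j}. z l *\<^sub>R x l) = 0" by (rule sum.neutral) (auto simp: z_def)
  then have "(\<Sum>l\<in>I. z l *\<^sub>R x l) = 0"
    using ij sum_remove_pair[OF fin ij(1-3), of "\<lambda>l. z l *\<^sub>R x l"] by (simp add: z_def)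
  moreover have "z i \<noteq> 0" by (simp add: z_def)
  ultimately show ?thesis using ij by blast
qed

lemma exists_normalized_linear_relation:
  fixes x :: "'i \<Rightarrow> 'a::euclidean_space"
  assumes fin: "finite I" and card: "DIM('a) < card I"
  shows "\<exists>z. (\<Sum>i\<in>I. z i *\<^sub>R x i) = 0 \<and> (\<Sum>i\<in>I. (z i)\<^sup>2) = 1"
proof -
  obtain z i where z: "(\<Sum>i\<in>I. z i *\<^sub>R x i) = 0" "i \<in> I" "z i \<noteq> 0"
    using exists_linear_relation[OF assms] by blast
  define s where "s = (\<Sum>i\<in>I. (z i)\<^sup>2)"
  have s: "s > 0" unfolding s_def by (rule sum_pos2[OF fin z(2)]) (use z in auto)
  have "(\<Sum>i\<in>I. (z i / sqrt s) *\<^sub>R x i) = (1 / sqrt s) *\<^sub>R (\<Sum>i\<in>I. z i *\<^sub>R x i)"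
    by (simp add: scaleR_sum_right)
  moreover have "(\<Sum>i\<in>I. (z i / sqrt s)\<^sup>2) = 1"
    using s by (simp add: power_divide s_def[symmetric] flip: sum_divide_distrib)
  ultimately show ?thesis using z(1) by (intro exI[of _ "\<lambda>i. z i / sqrt s"]) simp
qed

text \<open>Pairing the relation with \<open>z i *\<^sub>R x i\<close> expresses
  \<open>(z i)\<^sup>2\<close> through the off-diagonal terms of row \<open>i\<close>; the triangle
  inequality is applied in each row and the rows are added.\<close>

lemma sum_off_diagonal_ge_1:
  fixes x :: "'i \<Rightarrow> 'a::real_inner"
  assumes fin: "finite I" and unit: "\<And>i. i \<in> I \<Longrightarrow> norm (x i) = 1"
    and z: "(\<Sum>i\<in>I. z i *\<^sub>R x i) = 0" "(\<Sum>i\<in>I. (z i)\<^sup>2) = 1"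
  shows "1 \<le> (\<Sum>i\<in>I. \<Sum>j\<in>I - {i}. \<bar>z i * z j\<bar> * \<bar>x i \<bullet> x j\<bar>)"
proof -
  have split: "0 = (z i)\<^sup>2 + (\<Sum>j\<in>I - {i}. z i * z j * (x i \<bullet> x j))" if "i \<in> I" for i
  proof -
    have "0 = (z i *\<^sub>R x i) \<bullet> (\<Sum>j\<in>I. z j *\<^sub>R x j)" using z by simp
    also have "\<dots> = (\<Sum>j\<in>I. z i * z j * (x i \<bullet> x j))"
      by (simp add: inner_sum_right algebra_simps)
    also have "\<dots> = z i * z i * (x i \<bullet> x i) + (\<Sum>j\<in>I - {i}. z i * z j * (x i \<bullet> x j))"
      by (rule sum.remove[OF fin that])
    also have "x i \<bullet> x i = 1" using unit[OF that] by (simp add: dot_square_norm)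
    finally show ?thesis by (simp add: power2_eq_square)
  qed
  have "(z i)\<^sup>2 \<le> (\<Sum>j\<in>I - {i}. \<bar>z i * z j\<bar> * \<bar>x i \<bullet> x j\<bar>)" if "i \<in> I" for i
  proof -
    have "(z i)\<^sup>2 \<le> \<bar>\<Sum>j\<in>I - {i}. z i * z j * (x i \<bullet> x j)\<bar>" using split[OF that] by linarith
    also have "\<dots> \<le> (\<Sum>j\<in>I - {i}. \<bar>z i * z j * (x i \<bullet> x j)\<bar>)" by (rule sum_abs)
    finally show ?thesis by (simp add: abs_mult)
  qed
  then have "(\<Sum>i\<in>I. (z i)\<^sup>2) \<le> (\<Sum>i\<in>I. \<Sum>j\<in>I - {i}. \<bar>z i * z j\<bar> * \<bar>x i \<bullet> x j\<bar>)"
    by (rule sum_mono)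
  then show ?thesis using z by simp
qed

lemma sum_off_diagonal_powr:
  fixes z :: "'i \<Rightarrow> real"
  assumes fin: "finite I"
  shows "(\<Sum>i\<in>I. \<Sum>j\<in>I - {i}. \<bar>z i * z j\<bar> powr (2 * a)) = cross_power a I (\<lambda>i. (z i)\<^sup>2)"
proof -
  define s where "s = (\<lambda>i. ((z i)\<^sup>2) powr a)"
  have s': "((z i)\<^sup>2) powr a = s i" for i by (simp add: s_def)
  have s: "s i = \<bar>z i\<bar> powr (2 * a)" for i
  proof -
    have "\<bar>z i\<bar> powr (2 * a) = (\<bar>z i\<bar> powr 2) powr a" by (simp only: powr_powr)
    also have "\<bar>z i\<bar> powr 2 = (z i)\<^sup>2" by (cases "z i = 0") (auto simp: powr_numeral)
    finally show ?thesis by (simp add: s_def)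
  qed
  have "(\<Sum>i\<in>I. \<Sum>j\<in>I - {i}. \<bar>z i * z j\<bar> powr (2 * a)) = (\<Sum>i\<in>I. \<Sum>j\<in>I - {i}. s i * s j)"
    by (simp add: s abs_mult powr_mult)
  also have "\<dots> = (\<Sum>i\<in>I. (\<Sum>j\<in>I. s i * s j) - (s i)\<^sup>2)"
    by (rule sum.cong) (use fin in \<open>auto simp: sum_diff1 power2_eq_square\<close>)
  also have "\<dots> = cross_power a I (\<lambda>i. (z i)\<^sup>2)"
    unfolding cross_power_def s' sum_subtractf
    by (simp add: power2_eq_square sum_product)
  finally show ?thesis .
qed

section \<open>The minimal value and the families attaining it\<close>

text \<open>For \<open>k \<ge> 1\<close>, the logarithm of the value
  \<open>real (k + 1) * real k powr (1 - p)\<close> in the theorem.\<close>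

definition log_energy :: "real \<Rightarrow> nat \<Rightarrow> real" where
  "log_energy p k = ln (real k + 1) - (p - 1) * ln (real k)"

lemma exp_log_energy:
  assumes "k \<ge> 1"
  shows "exp (log_energy p k) = real (k + 1) * real k powr (1 - p)"
proof -
  have "log_energy p k = ln (real (k + 1)) + (1 - p) * ln (real k)"
    by (simp add: log_energy_def algebra_simps)
  moreover have "exp ((1 - p) * ln (real k)) = real k powr (1 - p)"
    using assms by (simp add: powr_def)
  ultimately show ?thesis by (simp add: exp_add)
qed

text \<open>The left side is \<open>cross_power\<close> at the uniform point on \<open>k + 1\<close>
  coordinates when \<open>2 * a = r + 1\<close>. As \<open>r > 0\<close>, minimizing
  \<open>log_energy\<close> amounts to maximizing this value.\<close>

lemma exp_scaled_log_energy:
  assumes "k \<ge> 1" "p > 1"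
  defines "r \<equiv> 1 / (p - 1)"
  shows "real k * real (k + 1) powr (- r) = exp (- r * log_energy p k)"
proof -
  have "- r * log_energy p k = ln (real k) + (- r) * ln (real (k + 1))"
    using assms by (simp add: log_energy_def field_simps)
  then have "exp (- r * log_energy p k) = exp (ln (real k)) * exp ((- r) * ln (real (k + 1)))"
    by (simp only: exp_add)
  then show ?thesis using assms(1) by (simp add: powr_def)
qed

text \<open>The reindexing lists \<open>S\<close> first and its complement afterwards.\<close>

lemma is_L_I:
  fixes x :: "nat \<Rightarrow> real ^ 'n"
  assumes S: "S \<subseteq> {1..d + 1}" "card S = m + 1" "m \<le> d"
    and g: "\<And>i j. i \<in> {1..d + 1} \<Longrightarrow> j \<in> {1..d + 1} \<Longrightarrow>
      \<bar>x i \<bullet> x j\<bar> = (if i = j then 1 else if i \<in> S \<and> j \<in> S then 1 / real m else 0)"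
  shows "is_L d m x"
proof -
  have finS: "finite S" using S(1) finite_subset by blast
  have "card {1..m + 1} = card S" using S by simp
  then obtain f where f: "bij_betw f {1..m + 1} S"
    using finS finite_same_card_bij by blast
  have "card {m + 2..d + 1} = card ({1..d + 1} - S)"
    using S finS by (simp add: card_Diff_subset)
  then obtain h where h: "bij_betw h {m + 2..d + 1} ({1..d + 1} - S)"
    by (metis finite_atLeastAtMost finite_Diff finite_same_card_bij)
  define \<sigma> where "\<sigma> = (\<lambda>i. if i \<in> {1..m + 1} then f i else h i)"
  have "bij_betw \<sigma> {1..m + 1} S"
    using f by (subst bij_betw_cong[of _ _ f]) (auto simp: \<sigma>_def)
  moreover have "bij_betw \<sigma> {m + 2..d + 1} ({1..d + 1} - S)"
    using h by (subst bij_betw_cong[of _ _ h]) (auto simp: \<sigma>_def)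
  ultimately have "bij_betw \<sigma> ({1..m + 1} \<union> {m + 2..d + 1}) (S \<union> ({1..d + 1} - S))"
    by (rule bij_betw_combine) auto
  moreover have "{1..m + 1} \<union> {m + 2..d + 1} = {1..d + 1}" using S(3) by auto
  moreover have "S \<union> ({1..d + 1} - S) = {1..d + 1}" using S(1) by auto
  ultimately have bij: "bij_betw \<sigma> {1..d + 1} {1..d + 1}" by simp
  have mem: "\<sigma> i \<in> S \<longleftrightarrow> i \<in> {1..m + 1}" if "i \<in> {1..d + 1}" for i
  proof (cases "i \<in> {1..m + 1}")
    case True
    then show ?thesis using bij_betwE[OF f] by (auto simp: \<sigma>_def)
  next
    case False
    then have "i \<in> {m + 2..d + 1}" using that by auto
    then show ?thesis using bij_betwE[OF h] False by (auto simp: \<sigma>_def)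
  qed
  show ?thesis unfolding is_L_def
  proof (intro exI[of _ \<sigma>] conjI ballI bij)
    fix i j assume ij: "i \<in> {1..d + 1}" "j \<in> {1..d + 1}"
    then have "\<sigma> i \<in> {1..d + 1}" "\<sigma> j \<in> {1..d + 1}" using bij_betwE[OF bij] by auto
    moreover have "\<sigma> i = \<sigma> j \<longleftrightarrow> i = j"
      using bij_betw_imp_inj_on[OF bij] ij by (auto dest: inj_onD)
    ultimately show "\<bar>x (\<sigma> i) \<bullet> x (\<sigma> j)\<bar> = L_entry m i j"
      using g mem ij by (simp add: L_entry_def)
  qed
qed

lemma frame_potential_is_L:
  fixes x :: "nat \<Rightarrow> real ^ 'n"
  assumes L: "is_L d k x" and k: "1 \<le> k" "k \<le> d"
  shows "frame_potential p (d + 1) x = real (k + 1) * real k powr (1 - p)"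
proof -
  let ?I = "{1..d + 1}" and ?K = "{1..k + 1}"
  obtain \<sigma> where \<sigma>: "bij_betw \<sigma> ?I ?I"
      "\<And>i j. i \<in> ?I \<Longrightarrow> j \<in> ?I \<Longrightarrow> \<bar>x (\<sigma> i) \<bullet> x (\<sigma> j)\<bar> = L_entry k i j"
    using L unfolding is_L_def by blast
  have \<sigma>': "bij_betw \<sigma> (?I - {i}) (?I - {\<sigma> i})" if "i \<in> ?I" for i
    using bij_betw_DiffI[OF \<sigma>(1), of "{i}" "{\<sigma> i}"] that bij_betwE[OF \<sigma>(1)]
    by (auto simp: bij_betw_def)
  have sub: "?K \<subseteq> ?I" using k by auto
  have "frame_potential p (d + 1) x
      = (\<Sum>i\<in>?I. \<Sum>j\<in>?I - {\<sigma> i}. \<bar>x (\<sigma> i) \<bullet> x j\<bar> powr p)"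
    unfolding frame_potential_def by (rule sum.reindex_bij_betw[OF \<sigma>(1), symmetric])
  also have "\<dots> = (\<Sum>i\<in>?I. \<Sum>j\<in>?I - {i}. \<bar>x (\<sigma> i) \<bullet> x (\<sigma> j)\<bar> powr p)"
    by (rule sum.cong[OF refl], rule sum.reindex_bij_betw[OF \<sigma>', symmetric])
  also have "\<dots> = (\<Sum>i\<in>?I. \<Sum>j\<in>?I - {i}. if i \<in> ?K \<and> j \<in> ?K then (1 / real k) powr p else 0)"
    by (intro sum.cong refl) (auto simp: \<sigma>(2) L_entry_def)
  also have "\<dots> = (\<Sum>i\<in>?K. \<Sum>j\<in>?I - {i}. if i \<in> ?K \<and> j \<in> ?K then (1 / real k) powr p else 0)"
    by (rule sum.mono_neutral_right) (use sub in auto)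
  also have "\<dots> = (\<Sum>i\<in>?K. \<Sum>j\<in>?K - {i}. (1 / real k) powr p)"
    by (intro sum.cong refl sum.mono_neutral_cong_right) (use sub in auto)
  also have "\<dots> = (\<Sum>i\<in>?K. real k * (1 / real k) powr p)"
    by (intro sum.cong refl) (simp add: card_Diff_singleton)
  also have "\<dots> = real (k + 1) * (real k * (1 / real k) powr p)"
    by simp
  also have "real k * (1 / real k) powr p = real k powr (1 - p)"
    using k by (simp add: powr_divide powr_diff)
  finally show ?thesis .
qed

section \<open>Lower bound and equality for \<open>1 < p < 2\<close>\<close>

text \<open>The equality case yields some \<open>m\<close> with the same energy as \<open>k\<close>,
  not \<open>k\<close> itself, because two values tie at a threshold.\<close>

lemma frame_potential_bound:
  fixes x :: "nat \<Rightarrow> real ^ 'n"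
  assumes dim: "CARD('n) = d" and unit: "unit_family (d + 1) x" and p: "1 < p" "p < 2"
    and k: "1 \<le> k" "k \<le> d"
    and opt: "\<And>j. 1 \<le> j \<Longrightarrow> j \<le> d \<Longrightarrow> log_energy p k \<le> log_energy p j"
  shows "real (k + 1) * real k powr (1 - p) \<le> frame_potential p (d + 1) x"
    and "frame_potential p (d + 1) x = real (k + 1) * real k powr (1 - p) \<Longrightarrow>
      \<exists>m. 1 \<le> m \<and> m \<le> d \<and> log_energy p m = log_energy p k \<and> is_L d m x"
proof -
  let ?I = "{1..d + 1}"
  define r where "r = 1 / (p - 1)"
  define a where "a = (r + 1) / 2"
  \<comment> \<open>By \<open>opt\<close> this is the maximum of \<open>cross_power\<close> on the
    simplex; \<open>B powr (1 - p)\<close> is the claimed bound since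
    \<open>r * (p - 1) = 1\<close>.\<close>
  define B where "B = exp (- r * log_energy p k)"
  define P where "P = Sigma ?I (\<lambda>i. ?I - {i})"
  have finP: "finite P" by (simp add: P_def)
  have unit': "norm (x i) = 1" if "i \<in> ?I" for i using unit that by (simp add: unit_family_def)
  have r: "r > 0" using p by (simp add: r_def)
  have a2: "2 * a = r + 1" by (simp add: a_def)
  have B: "B > 0" by (simp add: B_def)
  have BE: "B powr (1 - p) = real (k + 1) * real k powr (1 - p)"
  proof -
    have "B powr (1 - p) = exp ((1 - p) * (- r * log_energy p k))" by (simp add: B_def powr_def)
    also have "(1 - p) * (- r * log_energy p k) = log_energy p k"
      using p by (simp add: r_def field_simps)
    finally show ?thesis using exp_log_energy[OF k(1)] by simp
  qed
  obtain z where z: "(\<Sum>i\<in>?I. z i *\<^sub>R x i) = 0" "(\<Sum>i\<in>?I. (z i)\<^sup>2) = 1"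
    using exists_normalized_linear_relation[of ?I x] dim by auto
  define g where "g = (\<lambda>(i, j). \<bar>x i \<bullet> x j\<bar>)"
  define w where "w = (\<lambda>(i, j). \<bar>z i * z j\<bar>)"
  have sumP: "sum f P = (\<Sum>i\<in>?I. \<Sum>j\<in>?I - {i}. f (i, j))" for f :: "_ \<Rightarrow> real"
    unfolding P_def by (subst sum.Sigma) auto
  have FP: "frame_potential p (d + 1) x = (\<Sum>e\<in>P. g e powr p)"
    by (simp add: frame_potential_def sumP g_def)
  have pairing: "1 \<le> (\<Sum>e\<in>P. w e * g e)"
    using sum_off_diagonal_ge_1[OF _ unit' z] by (simp add: sumP g_def w_def)
  have Wcp: "(\<Sum>e\<in>P. w e powr (r + 1)) = cross_power a ?I (\<lambda>i. (z i)\<^sup>2)"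
    using sum_off_diagonal_powr[of ?I z a] by (simp add: sumP w_def a2)
  \<comment> \<open>\<open>m\<close> counts support points, while the energy is indexed by
    \<open>m - 1\<close>; a single point gives the value 0.\<close>
  have card_bound: "(real m - 1) * real m powr (1 - 2 * a) \<le> B" if "1 \<le> m" "m \<le> card ?I" for m
  proof (cases "m = 1")
    case True
    then show ?thesis using B by simp
  next
    case False
    define j where "j = m - 1"
    have j: "m = j + 1" "1 \<le> j" "j \<le> d" using False that by (auto simp: j_def)
    then have "(real m - 1) * real m powr (1 - 2 * a) = exp (- r * log_energy p j)"
      using exp_scaled_log_energy[OF j(2) p(1)] by (simp add: a2 r_def)
    also have "\<dots> \<le> B" using opt[OF j(2,3)] r by (simp add: B_def)
    finally show ?thesis .
  qed
  have a1: "a > 1" using p by (simp add: a_def r_def field_simps)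
  have W_le: "(\<Sum>e\<in>P. w e powr (r + 1)) \<le> B"
    unfolding Wcp by (rule cross_power_le(1)[OF _ a1 _ z(2) card_bound]) auto
  have nonneg: "0 \<le> g e" "0 \<le> w e" for e by (auto simp: g_def w_def split: prod.splits)
  note dual = sum_powr_dual_bound[OF p(1) finP B nonneg pairing, folded r_def, OF W_le]
  show "real (k + 1) * real k powr (1 - p) \<le> frame_potential p (d + 1) x"
    using dual(1) unfolding FP BE .
  assume "frame_potential p (d + 1) x = real (k + 1) * real k powr (1 - p)"
  then have "(\<Sum>e\<in>P. g e powr p) = B powr (1 - p)" unfolding FP BE .
  from dual(2)[OF this] have cpB: "cross_power a ?I (\<lambda>i. (z i)\<^sup>2) = B"
    and gw: "\<And>e. e \<in> P \<Longrightarrow> g e = w e powr r / B" unfolding Wcp by auto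
  have "\<exists>S\<subseteq>?I. S \<noteq> {} \<and> (\<forall>i\<in>?I. (z i)\<^sup>2 = (if i \<in> S then 1 / real (card S) else 0))"
    by (rule cross_power_le(2)[OF _ a1 _ z(2) card_bound cpB]) auto
  then obtain S where S: "S \<subseteq> ?I" "S \<noteq> {}"
      and zS: "\<And>i. i \<in> ?I \<Longrightarrow> (z i)\<^sup>2 = (if i \<in> S then 1 / real (card S) else 0)"
    by blast
  have finS: "finite S" using S(1) finite_subset by blast
  have BS: "B = (real (card S) - 1) * real (card S) powr (- r)"
    using cross_power_uniform[OF finS S(2,1) _ zS, of a] cpB by (simp add: a2)
  have "card S \<noteq> 1" using BS B by auto
  moreover have "card S > 0" using S finS by (simp add: card_gt_0_iff)
  moreover have "card S \<le> d + 1" using card_mono[OF _ S(1)] by simp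
  moreover define m where "m = card S - 1"
  ultimately have m: "card S = m + 1" "1 \<le> m" "m \<le> d" by auto
  have Bm: "B = real m * real (m + 1) powr (- r)" using BS m by simp
  then have "B = exp (- r * log_energy p m)"
    using exp_scaled_log_energy[OF m(2) p(1)] by (simp add: r_def)
  then have lm: "log_energy p m = log_energy p k" using r by (simp add: B_def)
  have absz: "\<bar>z i\<bar> = (if i \<in> S then sqrt (1 / real (m + 1)) else 0)" if "i \<in> ?I" for i
    using zS[OF that] m(1) real_sqrt_abs[of "z i"] by auto
  have "is_L d m x"
  proof (rule is_L_I[OF S(1) m(1,3)])
    fix i j assume ij: "i \<in> ?I" "j \<in> ?I"
    show "\<bar>x i \<bullet> x j\<bar> = (if i = j then 1 else if i \<in> S \<and> j \<in> S then 1 / real m else 0)"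
    proof (cases "i = j")
      case True
      then show ?thesis using unit'[OF ij(1)] by (simp add: dot_square_norm)
    next
      case False
      then have "(i, j) \<in> P" using ij by (auto simp: P_def)
      \<comment> \<open>Equality in the dual bound determines the inner products: \<open>w\<close>
        is constant on distinct pairs inside \<open>S\<close> and 0 on all others, where
        \<open>0 powr r = 0\<close>.\<close>
      then have "\<bar>x i \<bullet> x j\<bar> = w (i, j) powr r / B" using gw[of "(i, j)"] by (simp add: g_def)
      also have "w (i, j) = (if i \<in> S \<and> j \<in> S then 1 / real (m + 1) else 0)"
        unfolding w_def using absz[OF ij(1)] absz[OF ij(2)] by (simp add: abs_mult)
      finally have "\<bar>x i \<bullet> x j\<bar> = (if i \<in> S \<and> j \<in> S then 1 / real (m + 1) else 0) powr r / B" .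
      moreover have "(1 / real (m + 1)) powr r / B = 1 / real m"
        unfolding Bm using m(2) by (simp add: powr_divide powr_minus field_simps)
      ultimately show ?thesis using False by (simp split: if_splits)
    qed
  qed
  then show "\<exists>m. 1 \<le> m \<and> m \<le> d \<and> log_energy p m = log_energy p k \<and> is_L d m x"
    using m lm by blast
qed

section \<open>Thresholds and comparison of energies\<close>

text \<open>The difference of consecutive energies is affine and strictly decreasing in
  \<open>p\<close>, with its zero at the threshold. The index \<open>d\<close> is excluded because
  its threshold is 2 by convention.\<close>

lemma p_threshold_comparison:
  assumes "1 \<le> k" "k \<noteq> d"
  shows "p < p_threshold d k \<longleftrightarrow> log_energy p k < log_energy p (k + 1)"
    and "p = p_threshold d k \<longleftrightarrow> log_energy p k = log_energy p (k + 1)"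
    and "1 < p_threshold d k"
proof -
  define L where "L = ln (real (k + 1)) - ln (real k)"
  have L: "L > 0" using assms by (simp add: L_def)
  have P: "p_threshold d k = (ln (real (k + 2)) - ln (real k)) / L"
    using assms by (simp add: p_threshold_def L_def)
  have E: "log_energy p (k + 1) - log_energy p k = ln (real (k + 2)) - ln (real k) - p * L"
    by (simp add: log_energy_def L_def algebra_simps)
  show "p < p_threshold d k \<longleftrightarrow> log_energy p k < log_energy p (k + 1)"
    "p = p_threshold d k \<longleftrightarrow> log_energy p k = log_energy p (k + 1)"
    unfolding P using L E by (auto simp: field_simps)
  have "ln (real (k + 1)) < ln (real (k + 2))" by simp
  then show "1 < p_threshold d k" unfolding P using L by (simp add: L_def)
qed

lemma log_energy_unimodal:
  assumes p: "1 < p" "p < 2" and ijk: "1 \<le> i" "i < j" "j < k"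
    and le: "log_energy p i \<le> log_energy p j"
  shows "log_energy p j < log_energy p k"
  unfolding log_energy_def
  by (rule log_profile_unimodal[of _ "real i"]) (use p ijk le in \<open>auto simp: log_energy_def\<close>)

text \<open>Absolute inner products of unit vectors are at most 1. This carries the bound from an
  exponent above 1 down to \<open>p \<le> 1\<close>.\<close>

lemma frame_potential_antimono:
  fixes x :: "nat \<Rightarrow> real ^ 'n"
  assumes unit: "unit_family N x" and pq: "0 < p" "p \<le> q"
  shows "frame_potential q N x \<le> frame_potential p N x"
  unfolding frame_potential_def
proof (intro sum_mono)
  fix i j assume "i \<in> {1..N}" "j \<in> {1..N} - {i}"
  then have "\<bar>x i \<bullet> x j\<bar> \<le> 1"
    using Cauchy_Schwarz_ineq2[of "x i" "x j"] unit by (auto simp: unit_family_def)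
  then show "\<bar>x i \<bullet> x j\<bar> powr q \<le> \<bar>x i \<bullet> x j\<bar> powr p"
    using pq by (intro powr_mono') auto
qed

text \<open>Unimodality makes a local minimum global. Strictness holds from distance 2 on even if a
  neighbour ties, so only neighbours remain to be examined at equality.\<close>

lemma log_energy_local_minimum:
  assumes p: "1 < p" "p < 2" and k: "1 \<le> k" "k \<le> d"
    and lower: "k = 1 \<or> log_energy p k \<le> log_energy p (k - 1)"
    and upper: "k = d \<or> log_energy p k \<le> log_energy p (k + 1)"
    and j: "1 \<le> j" "j \<le> d"
  shows "log_energy p k \<le> log_energy p j"
    and "j + 1 < k \<or> k + 1 < j \<Longrightarrow> log_energy p k < log_energy p j"
proof -
  have less: "log_energy p k < log_energy p j" if far: "j + 1 < k \<or> k + 1 < j"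
    using far
  proof
    assume jk: "j + 1 < k"
    then have "j < k - 1" "k - 1 < k" by auto
    from log_energy_unimodal[OF p j(1) this] have "log_energy p (k - 1) < log_energy p j"
      using lower jk by force
    then show ?thesis using lower jk by auto
  next
    assume kj: "k + 1 < j"
    have "log_energy p (k + 1) < log_energy p j"
      by (rule log_energy_unimodal[OF p k(1) _ kj]) (use upper kj j in auto)
    then show ?thesis using upper kj j by auto
  qed
  then show "j + 1 < k \<or> k + 1 < j \<Longrightarrow> log_energy p k < log_energy p j" .
  show "log_energy p k \<le> log_energy p j"
  proof (cases "j + 1 < k \<or> k + 1 < j")
    case True
    then show ?thesis using less by simp
  next
    case False
    then have "j = k \<or> (j = k - 1 \<and> k \<noteq> 1) \<or> (j = k + 1 \<and> k \<noteq> d)" using j by linarith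
    then show ?thesis using lower upper by auto
  qed
qed

theorem theorem1p2:
  fixes d :: nat and p :: real and x :: "nat \<Rightarrow> real ^ 'n"
  assumes dim: "CARD('n) = d"
    and d_ge_2: "d \<ge> 2"
    and p_range: "p \<in> {0<..<2}"
    and unit: "unit_family (d + 1) x"
  shows "(\<forall>k\<in>{1..d}. p \<in> {p_threshold d (k - 1)<..<p_threshold d k} \<longrightarrow>
            frame_potential p (d + 1) x \<ge> real (k + 1) * real k powr (1 - p) \<and>
            (frame_potential p (d + 1) x = real (k + 1) * real k powr (1 - p) \<longleftrightarrow> is_L d k x))
       \<and> (\<forall>k\<in>{1..d - 1}. p = p_threshold d k \<longrightarrow>
            frame_potential p (d + 1) x \<ge> real (k + 1) * real k powr (1 - p) \<and>
            (frame_potential p (d + 1) x = real (k + 1) * real k powr (1 - p) \<longleftrightarrow>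
               is_L d k x \<or> is_L d (k + 1) x))"
proof (intro conjI ballI impI)
  \<comment> \<open>The exponent \<open>q\<close> is free because \<open>p \<le> 1\<close> is
    reduced to an exponent above 1.\<close>
  have between: "real (k + 1) * real k powr (1 - q) \<le> frame_potential q (d + 1) x"
      "frame_potential q (d + 1) x = real (k + 1) * real k powr (1 - q) \<Longrightarrow> is_L d k x"
    if k: "1 \<le> k" "k \<le> d" and q: "1 < q" "q < 2"
      and thr: "p_threshold d (k - 1) < q" "q < p_threshold d k" for k q
  proof -
    have lower: "k = 1 \<or> log_energy q k < log_energy q (k - 1)"
      using p_threshold_comparison(1,2)[of "k - 1" d q] k thr by fastforce
    have upper: "k = d \<or> log_energy q k < log_energy q (k + 1)"
      using p_threshold_comparison(1)[of k d q] k thr by auto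
    have min: "log_energy q k \<le> log_energy q j"
        "j + 1 < k \<or> k + 1 < j \<Longrightarrow> log_energy q k < log_energy q j" if "1 \<le> j" "j \<le> d" for j
      using log_energy_local_minimum[OF q k _ _ that] lower upper by auto
    note bound = frame_potential_bound[OF dim unit q k min(1)]
    show "real (k + 1) * real k powr (1 - q) \<le> frame_potential q (d + 1) x" by (rule bound(1))
    assume "frame_potential q (d + 1) x = real (k + 1) * real k powr (1 - q)"
    from bound(2)[OF _ _ this] obtain m where m: "1 \<le> m" "m \<le> d" "log_energy q m = log_energy q k"
      "is_L d m x" by blast
    have "\<not> (m + 1 < k \<or> k + 1 < m)" using min(2)[OF m(1,2)] m(3) by auto
    then have "m = k \<or> (m = k - 1 \<and> k \<noteq> 1) \<or> (m = k + 1 \<and> k \<noteq> d)" using m(1,2) by linarith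
    then have "m = k" using lower upper m(3) by auto
    then show "is_L d k x" using m(4) by simp
  qed
  fix k assume kd: "k \<in> {1..d}" and thr: "p \<in> {p_threshold d (k - 1)<..<p_threshold d k}"
  have k: "1 \<le> k" "k \<le> d" using kd by auto
  have "real (k + 1) * real k powr (1 - p) \<le> frame_potential p (d + 1) x \<and>
    (frame_potential p (d + 1) x = real (k + 1) * real k powr (1 - p) \<longrightarrow> is_L d k x)"
  proof (cases "p > 1")
    case True
    then show ?thesis using between[OF k True] p_range thr by auto
  next
    case False
    \<comment> \<open>The thresholds of positive index exceed 1, so an exponent
      \<open>p \<le> 1\<close> lies below all of them.\<close>
    have k1: "k = 1"
    proof (rule ccontr)
      assume "k \<noteq> 1"
      then have "1 < p_threshold d (k - 1)" using p_threshold_comparison(3)[of "k - 1" d] k by auto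
      then show False using thr False by auto
    qed
    then have "1 < min 2 (p_threshold d k)"
      using p_threshold_comparison(3)[of k d] d_ge_2 by auto
    \<comment> \<open>For \<open>k = 1\<close> the bound is 2 at every exponent, so it passes from
      \<open>q\<close> to \<open>p\<close>, and equality at \<open>p\<close> forces equality at
      \<open>q\<close>. The cap 2 serves the hypothesis \<open>q < 2\<close> of
      \<open>between\<close>.\<close>
    then obtain q where q: "1 < q" "q < min 2 (p_threshold d k)" using dense by blast
    have "p_threshold d (k - 1) < q" using q k1 by (simp add: p_threshold_def)
    then have "2 \<le> frame_potential q (d + 1) x" "frame_potential q (d + 1) x = 2 \<Longrightarrow> is_L d k x"
      using between[OF k, of q] q k1 by auto
    moreover have "frame_potential q (d + 1) x \<le> frame_potential p (d + 1) x"
      by (rule frame_potential_antimono[OF unit]) (use p_range q False in auto)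
    ultimately show ?thesis using k1 by auto
  qed
  then show "real (k + 1) * real k powr (1 - p) \<le> frame_potential p (d + 1) x"
    and "frame_potential p (d + 1) x = real (k + 1) * real k powr (1 - p) \<longleftrightarrow> is_L d k x"
    using frame_potential_is_L[OF _ k] by auto
next
  fix k assume kd: "k \<in> {1..d - 1}" and thr: "p = p_threshold d k"
  have k: "1 \<le> k" "k \<le> d" "k \<noteq> d" "k + 1 \<le> d" using kd d_ge_2 by auto
  have p: "1 < p" "p < 2" using p_threshold_comparison(3)[of k d] k thr p_range by auto
  have tie: "log_energy p k = log_energy p (k + 1)" using p_threshold_comparison(2) k thr by blast
  \<comment> \<open>If the energy at \<open>k - 1\<close> were at most that at \<open>k\<close>,
    unimodality would make it rise strictly from \<open>k\<close> to \<open>k + 1\<close>, against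
    \<open>tie\<close>.\<close>
  have lower: "k = 1 \<or> log_energy p k < log_energy p (k - 1)"
    using log_energy_unimodal[OF p, of "k - 1" k "k + 1"] tie k by force
  have min: "log_energy p k \<le> log_energy p j"
      "j + 1 < k \<or> k + 1 < j \<Longrightarrow> log_energy p k < log_energy p j" if "1 \<le> j" "j \<le> d" for j
    using log_energy_local_minimum[OF p k(1,2) _ _ that] lower tie by auto
  note bound = frame_potential_bound[OF dim unit p k(1,2) min(1)]
  show "real (k + 1) * real k powr (1 - p) \<le> frame_potential p (d + 1) x" by (rule bound(1))
  show "frame_potential p (d + 1) x = real (k + 1) * real k powr (1 - p) \<longleftrightarrow>
      is_L d k x \<or> is_L d (k + 1) x"
  proof
    assume "frame_potential p (d + 1) x = real (k + 1) * real k powr (1 - p)"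
    from bound(2)[OF _ _ this] obtain m where m: "1 \<le> m" "m \<le> d" "log_energy p m = log_energy p k"
      "is_L d m x" by blast
    have "\<not> (m + 1 < k \<or> k + 1 < m)" using min(2)[OF m(1,2)] m(3) by auto
    then have "m = k \<or> (m = k - 1 \<and> k \<noteq> 1) \<or> m = k + 1" using m(1) by linarith
    then have "m = k \<or> m = k + 1" using lower m(3) by auto
    then show "is_L d k x \<or> is_L d (k + 1) x" using m(4) by auto
  next
    \<comment> \<open>Exponentiating the tie shows that both families give the same value.\<close>
    have "real (k + 1) * real k powr (1 - p) = real (k + 1 + 1) * real (k + 1) powr (1 - p)"
      using exp_log_energy[of k p] exp_log_energy[of "k + 1" p] tie k by simp
    then show "is_L d k x \<or> is_L d (k + 1) x \<Longrightarrow>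
        frame_potential p (d + 1) x = real (k + 1) * real k powr (1 - p)"
      using frame_potential_is_L[of d k x p] frame_potential_is_L[of d "k + 1" x p] k by auto
  qed
qed

end
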